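(* Let $G$ be a group, $V$ be a set and $\rho\colon G\to\operatorname{Sym}(V)$ be a permutation representation of $G$ on $V$. There is a (simple, undirected) graph $\mathcal{G}$ such that (1) $V\subset V(\mathcal{G})$ and each $\psi\in\operatorname{Aut}(\mathcal{G})$ leaves $V$ invariant; (2) $\operatorname{Aut}(\mathcal{G}) \cong G$; (3) the restriction $G\cong \operatorname{Aut}(\mathcal{G})\to \operatorname{Sym}(V)$ is precisely $\rho$; and (4) there is a faithful action $\bar{\rho}\colon G\cong\operatorname{Aut}(\mathcal{G})\to \operatorname{Sym}\big(V(\mathcal{G})\setminus V\big)$ such that the restriction map $G\cong\operatorname{Aut}(\mathcal{G})\to\operatorname{Sym}\big(V(\mathcal{G})\big)$ is $\rho\oplus\bar{\rho}$. (Here the isomorphism $G\cong\operatorname{Aut}(\mathcal{G})$ is the same one in (2), (3) and (4).)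
   Context: Groups, sets and graphs are arbitrary (possibly infinite). A permutation representation of $G$ on $V$ is a group homomorphism $G\to\operatorname{Sym}(V)$, not necessarily injective, where $\operatorname{Sym}(V)$ is the group of all permutations of $V$. $V(\mathcal{G})$ is the vertex set of $\mathcal{G}$ and $\operatorname{Aut}(\mathcal{G})$ its group of graph automorphisms, acting on $V(\mathcal{G})$. For actions $\rho\colon G\to\operatorname{Sym}(A)$ and $\bar\rho\colon G\to\operatorname{Sym}(B)$, $\rho\oplus\bar\rho\colon G\to\operatorname{Sym}(A\sqcup B)$ denotes the action restricting to $\rho$ on $A$ and to $\bar\rho$ on $B$. *)

theory Defs
  imports "HOL-Algebra.Group_Action"
begin

text \<open>Simple undirected graphs, possibly infinite: no loops and no multiple edges.\<close>

record 'a ugraph =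
  verts :: "'a set"
  edges :: "'a set set"

definition simple_graph :: "'a ugraph \<Rightarrow> bool" where
  "simple_graph \<G> \<longleftrightarrow> edges \<G> \<subseteq> {{u, v} |u v. u \<in> verts \<G> \<and> v \<in> verts \<G> \<and> u \<noteq> v}"

text \<open>As for \<open>BijGroup\<close>, automorphisms are extensional functions, so that they are
  determined by their values on the vertices.\<close>

definition graph_auto :: "'a ugraph \<Rightarrow> ('a \<Rightarrow> 'a) set" where
  "graph_auto \<G> = {f \<in> Bij (verts \<G>).
     \<forall>u\<in>verts \<G>. \<forall>v\<in>verts \<G>. {f u, f v} \<in> edges \<G> \<longleftrightarrow> {u, v} \<in> edges \<G>}"

definition GraphAut :: "'a ugraph \<Rightarrow> ('a \<Rightarrow> 'a) monoid" where
  "GraphAut \<G> = BijGroup (verts \<G>) \<lparr>carrier := graph_auto \<G>\<rparr>"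

lemma subgroup_graph_auto: "subgroup (graph_auto \<G>) (BijGroup (verts \<G>))"
proof (rule group.subgroupI[OF group_BijGroup])
  show "graph_auto \<G> \<subseteq> carrier (BijGroup (verts \<G>))"
    by (auto simp: graph_auto_def BijGroup_def)
  have "(\<lambda>x\<in>verts \<G>. x) \<in> graph_auto \<G>"
    by (simp add: graph_auto_def id_Bij)
  then show "graph_auto \<G> \<noteq> {}" by blast
next
  fix f assume f: "f \<in> graph_auto \<G>"
  then have B: "f \<in> Bij (verts \<G>)" by (simp add: graph_auto_def)
  let ?h = "\<lambda>x\<in>verts \<G>. inv_into (verts \<G>) f x"
  have im: "f ` verts \<G> = verts \<G>" using B by (simp add: Bij_def bij_betw_def)
  have "{?h u, ?h v} \<in> edges \<G> \<longleftrightarrow> {u, v} \<in> edges \<G>"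
    if "u \<in> verts \<G>" "v \<in> verts \<G>" for u v
  proof -
    have "?h u \<in> verts \<G>" "?h v \<in> verts \<G>" "f (?h u) = u" "f (?h v) = v"
      using that im by (simp_all add: inv_into_into f_inv_into_f)
    then show ?thesis using f unfolding graph_auto_def by (metis (mono_tags, lifting) mem_Collect_eq)
  qed
  then show "inv\<^bsub>BijGroup (verts \<G>)\<^esub> f \<in> graph_auto \<G>"
    using B restrict_inv_into_Bij[OF B] by (simp add: inv_BijGroup graph_auto_def)
next
  fix f g assume "f \<in> graph_auto \<G>" "g \<in> graph_auto \<G>"
  then show "f \<otimes>\<^bsub>BijGroup (verts \<G>)\<^esub> g \<in> graph_auto \<G>"
    using Bij_imp_funcset[of g "verts \<G>"]
    by (auto simp: graph_auto_def BijGroup_def compose_Bij compose_eq Pi_iff)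
qed

lemma group_GraphAut: "group (GraphAut \<G>)"
  unfolding GraphAut_def
  by (rule subgroup.subgroup_is_group[OF subgroup_graph_auto group_BijGroup])

text \<open>The set \<open>V\<close> is identified with its copy \<open>Inl ` V\<close> in a sum type, which leaves room for
  further vertices even if \<open>V = UNIV\<close>. The action on the copy is:\<close>

definition inl_action :: "'v set \<Rightarrow> ('g \<Rightarrow> 'v \<Rightarrow> 'v) \<Rightarrow> 'g \<Rightarrow> 'v + 'w \<Rightarrow> 'v + 'w" where
  "inl_action V \<rho> g = (\<lambda>x\<in>Inl ` V. Inl (\<rho> g (projl x)))"

text \<open>The sum of an action on \<open>A\<close> and an action on \<open>B\<close>, for disjoint \<open>A\<close> and \<open>B\<close>.\<close>

definition action_sum ::
  "'a set \<Rightarrow> 'a set \<Rightarrow> ('g \<Rightarrow> 'a \<Rightarrow> 'a) \<Rightarrow> ('g \<Rightarrow> 'a \<Rightarrow> 'a) \<Rightarrow> 'g \<Rightarrow> 'a \<Rightarrow> 'a" where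
  "action_sum A B \<rho> \<sigma> g = (\<lambda>x\<in>A \<union> B. if x \<in> A then \<rho> g x else \<sigma> g x)"

text \<open>HOL cannot quantify existentially over types, so the type of the new vertices must be
  named. Lists over \<open>'g + 'v + nat\<close> form an infinite type at least as large as \<open>'g\<close> and \<open>'v\<close>;
  the only purpose of this choice is to provide enough vertices.\<close>

type_synonym ('g, 'v) vertex = "'v + ('g + 'v + nat) list"

end

theory Submission
  imports Defs
begin

text \<open>
  Let \<open>X = V \<squnion> G \<squnion> {*}\<close> with \<open>G\<close> acting by \<open>\<rho>\<close>, by left multiplication and trivially, and
  well-order \<open>X\<close>. The graph has a copy of \<open>X\<close> carrying the action (\<open>Top\<close>), a second copy of \<open>X\<close>
  on which \<open>G\<close> acts trivially (\<open>Lab\<close>), and a vertex \<open>Pair g i\<close> for each \<open>g \<in> G\<close> and \<open>i \<in> X\<close>. The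
  last is joined to \<open>Top (g \<cdot> i)\<close>, to all \<open>Lab j\<close> with \<open>i \<le> j\<close> and to all other \<open>Pair g k\<close>.
  A path \<open>Leaf\<close>, \<open>Hub\<close> is attached to \<open>Lab\<close>, and \<open>Top\<close> is made a clique
  (of size at least 2, thanks to \<open>*\<close>); so \<open>Leaf\<close> is the only vertex of degree 1, and automorphisms preserve the distance from it, which
  separates the five kinds of vertices. An automorphism permutes the blocks \<open>{Pair g i | i \<in> X}\<close>
  by some \<open>\<pi>\<close>, and since a well-order is rigid it sends \<open>Pair g i\<close> to \<open>Pair (\<pi> g) i\<close>.
  Hence it sends \<open>Top (g \<cdot> i)\<close> to \<open>Top (\<pi> g \<cdot> i)\<close>; comparing this for \<open>(g, i)\<close> and
  \<open>(1, g \<cdot> i)\<close> gives \<open>\<pi> g \<cdot> i = \<pi> 1 \<cdot> g \<cdot> i\<close>, and taking for \<open>i\<close> the unit of \<open>G\<close> gives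
  \<open>\<pi> g = \<pi> 1 \<cdot> g\<close>.
\<close>

section \<open>Rigidity of well-orders\<close>

text \<open>By well-founded induction \<open>t\<close> fixes everything strictly below
  \<open>x\<close>. If \<open>t x\<close> were below \<open>x\<close>, it would itself be fixed,
  against injectivity; if it were above, the preimage of \<open>x\<close> would lie strictly below
  \<open>x\<close> and hence be fixed.\<close>

lemma well_order_automorphism_eq_id:
  assumes wo: "well_order_on X r"
    and bij: "bij_betw t X X"
    and mono: "\<And>x y. x \<in> X \<Longrightarrow> y \<in> X \<Longrightarrow> (t x, t y) \<in> r \<longleftrightarrow> (x, y) \<in> r"
    and x: "x \<in> X"
  shows "t x = x"
proof -
  have wf: "wf (r - Id)" and total: "\<And>x y. x \<in> X \<Longrightarrow> y \<in> X \<Longrightarrow> x \<noteq> y \<Longrightarrow> (x, y) \<in> r \<or> (y, x) \<in> r"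
    using wo by (auto simp: well_order_on_def linear_order_on_def total_on_def)
  have inj: "inj_on t X" and im: "t ` X = X" using bij by (auto simp: bij_betw_def)
  from wf x show ?thesis
  proof (induction x)
    case (less x)
    have tx: "t x \<in> X" using im less.prems by blast
    show ?case
    proof (rule ccontr)
      assume ne: "t x \<noteq> x"
      consider "(t x, x) \<in> r" | "(x, t x) \<in> r" using total[OF tx less.prems ne] by blast
      then show False
      proof cases
        case 1
        then have "t (t x) = t x" using less.IH ne tx by blast
        then show False using inj tx less.prems ne by (meson inj_onD)
      next
        case 2
        obtain k where k: "k \<in> X" "t k = x" using im less.prems by (metis imageE)
        then have "(k, x) \<in> r" using 2 mono[OF k(1) less.prems] by simp
        moreover have "k \<noteq> x" using k ne by blast
        ultimately have "t k = k" using less.IH k by blast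
        then show False using k \<open>k \<noteq> x\<close> by simp
      qed
    qed
  qed
qed

section \<open>The graph and the action on it\<close>

datatype ('g, 'i) node = Leaf | Hub | Lab 'i | Pair 'g 'i | Top 'i

primrec act :: "('g, 'x) monoid_scheme \<Rightarrow> ('g \<Rightarrow> 'i \<Rightarrow> 'i) \<Rightarrow> 'g \<Rightarrow> ('g, 'i) node \<Rightarrow> ('g, 'i) node" where
  "act G a g Leaf = Leaf"
| "act G a g Hub = Hub"
| "act G a g (Lab i) = Lab i"
| "act G a g (Pair h i) = Pair (g \<otimes>\<^bsub>G\<^esub> h) i"
| "act G a g (Top x) = Top (a g x)"

text \<open>Each kind of edge is written out from the side of both endpoints, so that simplification
  computes the neighbours of any given node.\<close>

primrec adj :: "('g \<Rightarrow> 'i \<Rightarrow> 'i) \<Rightarrow> 'i rel \<Rightarrow> ('g, 'i) node \<Rightarrow> ('g, 'i) node \<Rightarrow> bool" where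
  "adj a r Leaf n \<longleftrightarrow> n = Hub"
| "adj a r Hub n \<longleftrightarrow> n = Leaf \<or> (\<exists>j. n = Lab j)"
| "adj a r (Lab j) n \<longleftrightarrow> n = Hub \<or> (\<exists>g i. n = Pair g i \<and> (i, j) \<in> r)"
| "adj a r (Pair g i) n \<longleftrightarrow>
     (\<exists>j. n = Lab j \<and> (i, j) \<in> r) \<or> (\<exists>k. n = Pair g k \<and> k \<noteq> i) \<or> n = Top (a g i)"
| "adj a r (Top x) n \<longleftrightarrow> (\<exists>g i. n = Pair g i \<and> x = a g i) \<or> (\<exists>y. n = Top y \<and> y \<noteq> x)"

lemma adj_sym: "adj a r m n \<longleftrightarrow> adj a r n m"
  by (cases m; cases n) auto

lemma adj_irrefl: "\<not> adj a r n n"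
  by (cases n) auto

text \<open>Isolates what the rigidity argument uses about the action on \<open>X\<close>: the point
  \<open>e\<close> has trivial stabiliser, and \<open>e'\<close> ensures that every
  \<open>Top x\<close> has a neighbour in the \<open>Top\<close> clique.\<close>

locale free_point_action = group G for G (structure) +
  fixes X :: "'i set" and a :: "'a \<Rightarrow> 'i \<Rightarrow> 'i" and r :: "'i rel" and e e' :: 'i
  assumes wo: "well_order_on X r"
    and a_closed: "g \<in> carrier G \<Longrightarrow> x \<in> X \<Longrightarrow> a g x \<in> X"
    and a_one: "x \<in> X \<Longrightarrow> a \<one> x = x"
    and a_mult: "g \<in> carrier G \<Longrightarrow> h \<in> carrier G \<Longrightarrow> x \<in> X \<Longrightarrow> a (g \<otimes> h) x = a g (a h x)"
    and e: "e \<in> X" and e': "e' \<in> X" and ne: "e' \<noteq> e"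
    and free: "g \<in> carrier G \<Longrightarrow> h \<in> carrier G \<Longrightarrow> a g e = a h e \<Longrightarrow> g = h"
begin

definition nodes :: "('a, 'i) node set" where
  "nodes = {Leaf, Hub} \<union> Lab ` X \<union> case_prod Pair ` (carrier G \<times> X) \<union> Top ` X"

lemma nodes_simps [simp]:
  "Leaf \<in> nodes" "Hub \<in> nodes" "Lab i \<in> nodes \<longleftrightarrow> i \<in> X"
  "Pair g i \<in> nodes \<longleftrightarrow> g \<in> carrier G \<and> i \<in> X" "Top i \<in> nodes \<longleftrightarrow> i \<in> X"
  by (auto simp: nodes_def)

lemma r_refl: "x \<in> X \<Longrightarrow> (x, x) \<in> r"
  using wo by (simp add: well_order_on_def linear_order_on_def partial_order_on_def
      preorder_on_def refl_on_def)

lemma r_trans: "(x, y) \<in> r \<Longrightarrow> (y, z) \<in> r \<Longrightarrow> (x, z) \<in> r"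
  using wo unfolding well_order_on_def linear_order_on_def partial_order_on_def preorder_on_def
  by (meson transD)

lemma r_antisym: "(x, y) \<in> r \<Longrightarrow> (y, x) \<in> r \<Longrightarrow> x = y"
  using wo unfolding well_order_on_def linear_order_on_def partial_order_on_def
  by (meson antisymD)

lemma act_closed: "g \<in> carrier G \<Longrightarrow> n \<in> nodes \<Longrightarrow> act G a g n \<in> nodes"
  by (cases n) (auto simp: a_closed)

lemma act_one: "n \<in> nodes \<Longrightarrow> act G a \<one> n = n"
  by (cases n) (auto simp: a_one)

lemma act_mult:
  "g \<in> carrier G \<Longrightarrow> h \<in> carrier G \<Longrightarrow> n \<in> nodes \<Longrightarrow> act G a (g \<otimes> h) n = act G a g (act G a h n)"
  by (cases n) (auto simp: a_mult m_assoc)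

lemma a_inj: "g \<in> carrier G \<Longrightarrow> x \<in> X \<Longrightarrow> y \<in> X \<Longrightarrow> a g x = a g y \<longleftrightarrow> x = y"
  by (metis a_mult a_one inv_closed l_inv)

lemma adj_act:
  "g \<in> carrier G \<Longrightarrow> m \<in> nodes \<Longrightarrow> n \<in> nodes \<Longrightarrow> adj a r (act G a g m) (act G a g n) \<longleftrightarrow> adj a r m n"
  by (cases m; cases n) (auto simp: a_inj a_closed a_mult)

section \<open>The vertex of degree one and the distance from it\<close>

text \<open>\<open>Leaf\<close> sees only \<open>Hub\<close>, while every other node has two
  neighbours of different kinds. The criterion mentions only \<open>adj\<close> and
  \<open>nodes\<close>, so it can be transported along an automorphism.\<close>

lemma Leaf_characterization:
  assumes n: "n \<in> nodes"
  shows "n = Leaf \<longleftrightarrow> (\<forall>p\<in>nodes. \<forall>q\<in>nodes. adj a r n p \<and> adj a r n q \<longrightarrow> p = q)"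
    (is "_ \<longleftrightarrow> ?unique n")
proof (cases n)
  case Hub
  then have "adj a r n Leaf" "adj a r n (Lab e)" by auto
  then show ?thesis using Hub e by (metis nodes_simps(1,3) node.distinct(1,3))
next
  case (Lab j)
  then have "adj a r n Hub" "adj a r n (Pair \<one> j)" "Pair \<one> j \<in> nodes" using n by (auto simp: r_refl)
  then show ?thesis using Lab by (metis nodes_simps(2) node.distinct(3,11))
next
  case (Pair g i)
  then have "adj a r n (Lab i)" "adj a r n (Top (a g i))" "Lab i \<in> nodes" "Top (a g i) \<in> nodes"
    using n by (auto simp: r_refl a_closed)
  then show ?thesis using Pair by (metis node.distinct(5,17))
next
  case (Top x)
  obtain y where "y \<in> X" "y \<noteq> x" using e e' ne by metis
  then have "adj a r n (Top y)" "adj a r n (Pair \<one> x)" "Pair \<one> x \<in> nodes" "Top y \<in> nodes"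
    using n Top by (auto simp: a_one)
  then show ?thesis using Top by (metis node.distinct(7,19))
qed auto

text \<open>This is the distance from \<open>Leaf\<close> in the graph.\<close>

primrec layer :: "('a, 'i) node \<Rightarrow> nat" where
  "layer Leaf = 0" | "layer Hub = 1" | "layer (Lab i) = 2" | "layer (Pair g i) = 3" | "layer (Top x) = 4"

context
  fixes f
  assumes bij: "bij_betw f nodes nodes"
    and pres: "\<And>m n. m \<in> nodes \<Longrightarrow> n \<in> nodes \<Longrightarrow> adj a r (f m) (f n) \<longleftrightarrow> adj a r m n"
begin

lemma f_closed: "n \<in> nodes \<Longrightarrow> f n \<in> nodes"
  using bij by (auto simp: bij_betw_def)

lemma f_surj: "n \<in> nodes \<Longrightarrow> \<exists>m\<in>nodes. f m = n"
  using bij by (metis bij_betw_imp_surj_on imageE)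

lemma f_eq_iff: "m \<in> nodes \<Longrightarrow> n \<in> nodes \<Longrightarrow> f m = f n \<longleftrightarrow> m = n"
  using bij unfolding bij_betw_def by (meson inj_on_eq_iff)

lemma f_eq_Leaf: assumes "n \<in> nodes" shows "f n = Leaf \<longleftrightarrow> n = Leaf"
proof -
  have "f n = Leaf \<longleftrightarrow>
      (\<forall>p\<in>f ` nodes. \<forall>q\<in>f ` nodes. adj a r (f n) p \<and> adj a r (f n) q \<longrightarrow> p = q)"
    using Leaf_characterization[OF f_closed[OF assms]] bij by (simp add: bij_betw_def)
  also have "\<dots> \<longleftrightarrow> n = Leaf"
    using Leaf_characterization[OF assms] assms by (simp add: pres f_eq_iff)
  finally show ?thesis .
qed

text \<open>\<open>Hub\<close> is the only neighbour of the fixed node \<open>Leaf\<close>.\<close>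

lemma f_eq_Hub: "n \<in> nodes \<Longrightarrow> f n = Hub \<longleftrightarrow> n = Hub"
  by (metis adj.simps(1) f_eq_Leaf nodes_simps(1) pres)

text \<open>Each layer is found from the earlier ones by adjacency: layer 2 consists of the
  neighbours of \<open>Hub\<close> other than \<open>Leaf\<close>, layer 3 of the nodes other than
  \<open>Hub\<close> with a neighbour in layer 2, and layer 4 is what remains.\<close>

lemma layer_f:
  assumes n: "n \<in> nodes" shows "layer (f n) = layer n"
proof -
  have two: "layer m = 2 \<longleftrightarrow> adj a r Hub m \<and> m \<noteq> Leaf" for m by (cases m) auto
  have f_two: "layer (f m) = 2 \<longleftrightarrow> layer m = 2" if "m \<in> nodes" for m
    using that pres[OF nodes_simps(2) that] f_eq_Hub[OF nodes_simps(2)] f_eq_Leaf[OF that]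
    by (simp add: two)
  have three: "layer m = 3 \<longleftrightarrow> m \<noteq> Hub \<and> (\<exists>l\<in>nodes. layer l = 2 \<and> adj a r m l)"
    if "m \<in> nodes" for m
  proof (cases m)
    case (Pair g i)
    then have "Lab i \<in> nodes" "adj a r m (Lab i)" using that by (auto simp: r_refl)
    then show ?thesis using Pair by (auto intro!: bexI[of _ "Lab i"])
  qed auto
  have f_three: "layer (f n) = 3 \<longleftrightarrow> layer n = 3"
  proof -
    have "(\<exists>l\<in>nodes. layer l = 2 \<and> adj a r (f n) l) \<longleftrightarrow> (\<exists>l\<in>nodes. layer (f l) = 2 \<and> adj a r (f n) (f l))"
      using f_surj f_closed by metis
    also have "\<dots> \<longleftrightarrow> (\<exists>l\<in>nodes. layer l = 2 \<and> adj a r n l)"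
      using f_two pres n by blast
    finally show ?thesis using three n f_closed f_eq_Hub by simp
  qed
  have zero: "layer m = 0 \<longleftrightarrow> m = Leaf" and one: "layer m = 1 \<longleftrightarrow> m = Hub"
    and le: "layer m \<le> 4" for m
    by (cases m; simp)+
  have "layer (f n) = 0 \<longleftrightarrow> layer n = 0" "layer (f n) = 1 \<longleftrightarrow> layer n = 1"
    using f_eq_Leaf f_eq_Hub n by (simp_all only: zero one)
  then show ?thesis using f_two[OF n] f_three le[of n] le[of "f n"] by linarith
qed

lemma f_Lab: "j \<in> X \<Longrightarrow> \<exists>k\<in>X. f (Lab j) = Lab k"
  using layer_f[of "Lab j"] f_closed[of "Lab j"] by (cases "f (Lab j)") auto

lemma f_Top: "x \<in> X \<Longrightarrow> \<exists>y\<in>X. f (Top x) = Top y"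
  using layer_f[of "Top x"] f_closed[of "Top x"] by (cases "f (Top x)") auto

lemma f_Pair: "g \<in> carrier G \<Longrightarrow> i \<in> X \<Longrightarrow> \<exists>h\<in>carrier G. \<exists>k\<in>X. f (Pair g i) = Pair h k"
  using layer_f[of "Pair g i"] f_closed[of "Pair g i"] by (cases "f (Pair g i)") auto

section \<open>Automorphisms act as group elements\<close>

text \<open>A block is a clique and no edge joins two different blocks, so the image of
  \<open>Pair g e\<close> determines the block \<open>h\<close> that receives all of block
  \<open>g\<close>.\<close>

lemma f_Pair_block:
  assumes g: "g \<in> carrier G"
  obtains h t where "h \<in> carrier G" "bij_betw t X X" "\<And>i. i \<in> X \<Longrightarrow> f (Pair g i) = Pair h (t i)"
proof -
  obtain h k where h: "h \<in> carrier G" and k: "k \<in> X" and fe: "f (Pair g e) = Pair h k"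
    using f_Pair[OF g e] by blast
  have "\<exists>l\<in>X. f (Pair g i) = Pair h l" if i: "i \<in> X" for i
  proof (cases "i = e")
    case False
    then have "adj a r (f (Pair g e)) (f (Pair g i))" using pres g i e by simp
    then show ?thesis using f_Pair[OF g i] fe by auto
  qed (use fe k in auto)
  then obtain t where t: "\<And>i. i \<in> X \<Longrightarrow> t i \<in> X \<and> f (Pair g i) = Pair h (t i)" by metis
  have "inj_on t X"
  proof (rule inj_onI)
    fix i j assume "i \<in> X" "j \<in> X" "t i = t j"
    then have "f (Pair g i) = f (Pair g j)" using t by simp
    then show "i = j" using \<open>i \<in> X\<close> \<open>j \<in> X\<close> g f_eq_iff by simp
  qed
  moreover have "y \<in> t ` X" if y: "y \<in> X" for y
  proof (cases "y = k")
    case True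
    then show ?thesis using t[OF e] fe e by force
  next
    case False
    \<comment> \<open>As \<open>y\<close> differs from \<open>k\<close>, the image of
      \<open>n\<close> is adjacent to that of \<open>Pair g e\<close>; hence \<open>n\<close> is
      adjacent to \<open>Pair g e\<close> and lies in block \<open>g\<close>.\<close>
    obtain n where n: "n \<in> nodes" "f n = Pair h y" using f_surj[of "Pair h y"] h y by auto
    then have "layer n = 3" using layer_f by fastforce
    then obtain g' z where z: "n = Pair g' z" by (cases n) auto
    have "adj a r (f (Pair g e)) (f n)" using fe n False by simp
    then have "g' = g" using pres[of "Pair g e" n] n g e z by auto
    then show ?thesis using t[of z] n z by auto
  qed
  ultimately have "bij_betw t X X" using t by (auto simp: bij_betw_def)
  then show ?thesis using that h t by blast
qed

text \<open>The edges between a block and the \<open>Lab\<close> nodes record the order, but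
  \<open>f\<close> may a priori permute the two sides by different maps \<open>t\<close> and
  \<open>\<alpha>\<close>. Once \<open>t\<close> is known to preserve the order, rigidity makes it
  the identity, and \<open>\<alpha>\<close> follows.\<close>

lemma f_Pair_eq:
  assumes g: "g \<in> carrier G"
  obtains h where "h \<in> carrier G" "\<And>i. i \<in> X \<Longrightarrow> f (Pair g i) = Pair h i"
    "\<And>j. j \<in> X \<Longrightarrow> f (Lab j) = Lab j"
proof -
  obtain h t where h: "h \<in> carrier G" and t: "bij_betw t X X"
    and ft: "\<And>i. i \<in> X \<Longrightarrow> f (Pair g i) = Pair h (t i)" using f_Pair_block[OF g] by metis
  obtain \<alpha> where \<alpha>: "\<And>j. j \<in> X \<Longrightarrow> \<alpha> j \<in> X \<and> f (Lab j) = Lab (\<alpha> j)" using f_Lab by metis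
  have tX: "t i \<in> X" if "i \<in> X" for i using t that by (auto simp: bij_betw_def)
  have \<alpha>_iff: "(t i, \<alpha> j) \<in> r \<longleftrightarrow> (i, j) \<in> r" if "i \<in> X" "j \<in> X" for i j
    using pres[of "Pair g i" "Lab j"] ft \<alpha> that g by simp
  have \<alpha>_surj: "\<exists>j\<in>X. \<alpha> j = k" if k: "k \<in> X" for k
  proof -
    obtain n where n: "n \<in> nodes" "f n = Lab k" using f_surj[of "Lab k"] k by auto
    then have "layer n = 2" using layer_f by fastforce
    then obtain j where j: "n = Lab j" by (cases n) auto
    then show ?thesis using n \<alpha>[of j] by auto
  qed
  \<comment> \<open>The order is recovered from inclusion of up-sets. Their members are indexed by
    the \<open>Lab\<close> side, so a reindexing by the surjection \<open>\<alpha>\<close> does no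
    harm.\<close>
  have via_upsets: "(x, y) \<in> r \<longleftrightarrow> (\<forall>j\<in>X. (y, j) \<in> r \<longrightarrow> (x, j) \<in> r)" if "x \<in> X" "y \<in> X" for x y
    using r_trans r_refl that by blast
  have t_iff: "(t x, t y) \<in> r \<longleftrightarrow> (x, y) \<in> r" if xy: "x \<in> X" "y \<in> X" for x y
  proof -
    have "(t x, t y) \<in> r \<longleftrightarrow> (\<forall>j\<in>X. (t y, \<alpha> j) \<in> r \<longrightarrow> (t x, \<alpha> j) \<in> r)"
      using via_upsets[of "t x" "t y"] xy tX \<alpha>_surj \<alpha> by metis
    then show ?thesis using via_upsets[of x y] \<alpha>_iff xy by blast
  qed
  have t_id: "t i = i" if "i \<in> X" for i
    using well_order_automorphism_eq_id[OF wo t t_iff that] .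
  \<comment> \<open>With \<open>t\<close> the identity, \<open>j\<close> and
    \<open>\<alpha> j\<close> have the same lower bounds; each is a lower bound of itself, so
    antisymmetry applies.\<close>
  have "\<alpha> j = j" if j: "j \<in> X" for j
    using \<alpha>_iff[OF j j] \<alpha>_iff[of "\<alpha> j" j] \<alpha>[OF j] t_id j r_refl r_antisym by metis
  then show ?thesis using that[OF h] ft t_id \<alpha> by metis
qed

lemma automorphism_eq_act: "\<exists>k\<in>carrier G. \<forall>n\<in>nodes. f n = act G a k n"
proof -
  have "\<forall>g\<in>carrier G. \<exists>h. h \<in> carrier G \<and> (\<forall>i\<in>X. f (Pair g i) = Pair h i)"
    using f_Pair_eq by metis
  then obtain p where p: "\<And>g. g \<in> carrier G \<Longrightarrow> p g \<in> carrier G"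
    "\<And>g i. g \<in> carrier G \<Longrightarrow> i \<in> X \<Longrightarrow> f (Pair g i) = Pair (p g) i" by metis
  have Lab: "f (Lab j) = Lab j" if "j \<in> X" for j using f_Pair_eq[OF one_closed] that by metis
  \<comment> \<open>\<open>Pair (p g) i\<close> has exactly one neighbour of kind
    \<open>Top\<close>.\<close>
  have Top: "f (Top (a g i)) = Top (a (p g) i)" if "g \<in> carrier G" "i \<in> X" for g i
  proof -
    have "adj a r (f (Pair g i)) (f (Top (a g i)))" using pres that a_closed by simp
    then show ?thesis using p f_Top[OF a_closed[OF that]] that by auto
  qed
  have Top1: "f (Top x) = Top (a (p \<one>) x)" if "x \<in> X" for x
    using Top[OF one_closed that] a_one[OF that] by simp
  have p_eq: "p g = p \<one> \<otimes> g" if g: "g \<in> carrier G" for g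
  proof (rule free)
    show "a (p g) e = a (p \<one> \<otimes> g) e"
      using Top[OF g e] Top1[OF a_closed[OF g e]] a_mult[OF p(1)[OF one_closed] g e] by simp
  qed (use p g in auto)
  have "f n = act G a (p \<one>) n" if n: "n \<in> nodes" for n
  proof (cases n)
    case (Pair g i)
    then show ?thesis using n p(2)[of g i] p_eq[of g] by simp
  qed (use n Top1 Lab f_eq_Leaf f_eq_Hub in auto)
  then show ?thesis using p(1)[OF one_closed] by blast
qed

end

end

section \<open>Group actions on sets and the transfer to the vertex type\<close>

text \<open>Bijectivity comes from the pointwise laws, the action of the inverse being a two-sided
  inverse. Extensionality turns agreement on \<open>E\<close> into the equality of functions that
  \<open>BijGroup\<close> requires.\<close>

lemma group_actionI:
  assumes "group G"
    and ext: "\<And>g. g \<in> carrier G \<Longrightarrow> \<phi> g \<in> extensional E"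
    and closed: "\<And>g x. g \<in> carrier G \<Longrightarrow> x \<in> E \<Longrightarrow> \<phi> g x \<in> E"
    and one: "\<And>x. x \<in> E \<Longrightarrow> \<phi> \<one>\<^bsub>G\<^esub> x = x"
    and mult: "\<And>g h x. g \<in> carrier G \<Longrightarrow> h \<in> carrier G \<Longrightarrow> x \<in> E \<Longrightarrow> \<phi> (g \<otimes>\<^bsub>G\<^esub> h) x = \<phi> g (\<phi> h x)"
  shows "group_action G E \<phi>"
proof -
  interpret group G by fact
  have cancel: "\<phi> (inv\<^bsub>G\<^esub> g) (\<phi> g x) = x" "\<phi> g (\<phi> (inv\<^bsub>G\<^esub> g) x) = x" if "g \<in> carrier G" "x \<in> E" for g x
    using that mult[of "inv\<^bsub>G\<^esub> g" g x] mult[of g "inv\<^bsub>G\<^esub> g" x] one by simp_all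
  have Bij: "\<phi> g \<in> Bij E" if g: "g \<in> carrier G" for g
  proof -
    have "bij_betw (\<phi> g) E E"
      by (rule bij_betw_byWitness[where f' = "\<phi> (inv\<^bsub>G\<^esub> g)"]) (use cancel closed g in auto)
    then show ?thesis using ext g by (simp add: Bij_def)
  qed
  have "\<phi> (g \<otimes>\<^bsub>G\<^esub> h) = compose E (\<phi> g) (\<phi> h)" if "g \<in> carrier G" "h \<in> carrier G" for g h
    using that mult ext by (intro extensionalityI[of _ E]) (auto simp: compose_eq)
  then have "\<phi> \<in> hom G (BijGroup E)"
    using Bij by (auto simp: hom_def BijGroup_def)
  then show ?thesis
    using group_BijGroup by (simp add: group_action_def group_hom_def group_hom_axioms_def is_group)
qed

text \<open>The list lengths 0, 1, 2, 3 and 4 separate the kinds of new vertices.\<close>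

primrec label :: "'v + 'g option \<Rightarrow> 'g + 'v + nat" where
  "label (Inl v) = Inr (Inl v)"
| "label (Inr h) = (case h of None \<Rightarrow> Inr (Inr 0) | Some h \<Rightarrow> Inl h)"

fun enc :: "('g, 'v + 'g option) node \<Rightarrow> ('g, 'v) vertex" where
  "enc Leaf = Inr []"
| "enc (Lab i) = Inr [label i]"
| "enc (Pair g i) = Inr [Inl g, label i]"
| "enc Hub = Inr (replicate 3 (Inr (Inr 0)))"
| "enc (Top (Inl v)) = Inl v"
| "enc (Top (Inr h)) = Inr (label (Inr h) # replicate 3 (Inr (Inr 0)))"

lemma label_eq_iff: "label i = label j \<longleftrightarrow> i = j"
  by (cases i; cases j) (auto split: option.splits)

lemma inj_enc: "inj enc"
proof (rule injI)
  fix m n :: "('g, 'v + 'g option) node"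
  assume "enc m = enc n"
  then show "m = n"
    by (cases m rule: enc.cases; cases n rule: enc.cases)
      (auto simp: label_eq_iff numeral_3_eq_3 simp del: label.simps)
qed

theorem theorem3p14:
  fixes G :: "('g, 'x) monoid_scheme"
    and V :: "'v set"
    and \<rho> :: "'g \<Rightarrow> 'v \<Rightarrow> 'v"
  assumes "group G"
    and "group_action G V \<rho>"
  shows "\<exists>(\<G> :: ('g, 'v) vertex ugraph) \<Phi>.
    simple_graph \<G> \<and>
    Inl ` V \<subseteq> verts \<G> \<and>
    (\<forall>\<psi>\<in>carrier (GraphAut \<G>). \<psi> ` (Inl ` V) = Inl ` V) \<and>
    \<Phi> \<in> iso G (GraphAut \<G>) \<and>
    (\<forall>g\<in>carrier G. restrict (\<Phi> g) (Inl ` V) = inl_action V \<rho> g) \<and>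
    (\<exists>\<rho>'. faithful_action G (verts \<G> - Inl ` V) \<rho>' \<and>
      (\<forall>g\<in>carrier G.
        \<Phi> g = action_sum (Inl ` V) (verts \<G> - Inl ` V) (inl_action V \<rho>) \<rho>' g))"
proof -
  interpret \<rho>: group_action G V \<rho> by fact
  interpret group G by fact
  \<comment> \<open>\<open>Some h\<close> carries left multiplication and \<open>None\<close> is a
    fixed point, present so that \<open>X\<close> has two elements even if \<open>V\<close> is empty
    and \<open>G\<close> trivial.\<close>
  define X :: "('v + 'g option) set" where "X = V <+> insert None (Some ` carrier G)"
  define a where "a g = map_sum (\<rho> g) (map_option (\<lambda>h. g \<otimes>\<^bsub>G\<^esub> h))" for g
  obtain r where r: "well_order_on X r" using well_order_on by blast
  have \<rho>_one: "\<rho> \<one>\<^bsub>G\<^esub> v = v" if "v \<in> V" for v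
    using \<rho>.id_eq_one that by (metis restrict_apply')
  \<comment> \<open>The free point is the unit of \<open>G\<close>, since \<open>g\<close> is
    recovered from its product with the unit.\<close>
  interpret free_point_action G X a r "Inr (Some \<one>\<^bsub>G\<^esub>)" "Inr None"
  proof
    show "a g x \<in> X" if "g \<in> carrier G" "x \<in> X" for g x
      using that \<rho>.element_image by (auto simp: a_def X_def)
    show "a \<one>\<^bsub>G\<^esub> x = x" if "x \<in> X" for x
      using that \<rho>_one by (auto simp: a_def X_def)
    show "a (g \<otimes>\<^bsub>G\<^esub> h) x = a g (a h x)" if "g \<in> carrier G" "h \<in> carrier G" "x \<in> X" for g h x
      using that \<rho>.composition_rule m_assoc by (auto simp: a_def X_def)
  qed (use r in \<open>auto simp: X_def a_def\<close>)
  define dec where "dec = inv_into UNIV (enc :: ('g, 'v + 'g option) node \<Rightarrow> _)"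
  have dec [simp]: "dec (enc n) = n" for n by (simp add: dec_def inj_enc)
  have enc_eq [simp]: "enc m = enc n \<longleftrightarrow> m = n" for m n :: "('g, 'v + 'g option) node"
    using inj_enc by (auto dest: injD)
  define \<G> :: "('g, 'v) vertex ugraph" where
    "\<G> = \<lparr>verts = enc ` nodes, edges = {{enc m, enc n} |m n. m \<in> nodes \<and> n \<in> nodes \<and> adj a r m n}\<rparr>"
  define \<Phi> where "\<Phi> g = (\<lambda>x\<in>verts \<G>. enc (act G a g (dec x)))" for g
  have verts: "verts \<G> = enc ` nodes" by (simp add: \<G>_def)
  have edge_iff: "{enc m, enc n} \<in> edges \<G> \<longleftrightarrow> adj a r m n" if "m \<in> nodes" "n \<in> nodes" for m n
    using that adj_sym[of a r m n] by (auto simp: \<G>_def doubleton_eq_iff)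
  have \<Phi>_enc [simp]: "\<Phi> g (enc n) = enc (act G a g n)" if "n \<in> nodes" for g n
    using that by (simp add: \<Phi>_def verts)
  have simple: "simple_graph \<G>"
    unfolding simple_graph_def \<G>_def using adj_irrefl enc_eq by fastforce
  \<comment> \<open>The given set \<open>V\<close> sits in the \<open>Top\<close> part, where the
    action is \<open>\<rho>\<close>.\<close>
  have InlV: "Inl ` V = enc ` Top ` Inl ` V" by (auto simp: image_iff)
  have InlX: "Inl v \<in> X" if "v \<in> V" for v using that by (auto simp: X_def)
  then have TopV: "Top ` Inl ` V \<subseteq> nodes" by auto
  have sub: "Inl ` V \<subseteq> verts \<G>" unfolding InlV verts using TopV by blast
  have \<Phi>_Inl: "\<Phi> g (Inl v) = Inl (\<rho> g v)" if "v \<in> V" for g v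
    using \<Phi>_enc[of "Top (Inl v)" g] InlX[OF that] by (simp add: a_def)
  have \<Phi>_action: "group_action G (verts \<G>) \<Phi>"
  proof (rule group_actionI)
    show "\<Phi> g \<in> extensional (verts \<G>)" for g by (simp add: \<Phi>_def)
  qed (auto simp: verts act_closed act_one act_mult \<open>group G\<close>)
  interpret \<Phi>: group_action G "verts \<G>" \<Phi> by (rule \<Phi>_action)
  have \<Phi>_V: "\<Phi> g ` Inl ` V = Inl ` V" if "g \<in> carrier G" for g
  proof -
    have "\<Phi> g ` Inl ` V = Inl ` \<rho> g ` V" using \<Phi>_Inl by (auto simp: image_iff)
    then show ?thesis using \<rho>.surj_prop that by simp
  qed
  have \<Phi>_auto: "\<Phi> g \<in> graph_auto \<G>" if "g \<in> carrier G" for g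
    using that \<Phi>.bij_prop0[OF that] by (auto simp: graph_auto_def verts edge_iff adj_act act_closed)
  have \<Phi>_surj: "\<exists>g\<in>carrier G. \<psi> = \<Phi> g" if \<psi>: "\<psi> \<in> graph_auto \<G>" for \<psi>
  proof -
    have \<psi>_Bij: "\<psi> \<in> extensional (verts \<G>)" "bij_betw \<psi> (verts \<G>) (verts \<G>)"
      using \<psi> by (auto simp: graph_auto_def Bij_def)
    have enc_bij: "bij_betw enc nodes (verts \<G>)" "bij_betw dec (verts \<G>) nodes"
      by (auto simp: bij_betw_def inj_on_def verts image_image)
    \<comment> \<open>Conjugation by the encoding turns \<open>\<psi>\<close> into an automorphism
      on \<open>nodes\<close>, to which \<open>automorphism_eq_act\<close> applies.\<close>
    have bij: "bij_betw (dec \<circ> \<psi> \<circ> enc) nodes nodes"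
      using enc_bij \<psi>_Bij(2) bij_betw_trans by metis
    have f_enc: "enc ((dec \<circ> \<psi> \<circ> enc) n) = \<psi> (enc n)" if "n \<in> nodes" for n
    proof -
      have "\<psi> (enc n) \<in> enc ` nodes" using \<psi>_Bij(2) that verts by (auto simp: bij_betw_def)
      then show ?thesis by auto
    qed
    have closed: "(dec \<circ> \<psi> \<circ> enc) n \<in> nodes" if "n \<in> nodes" for n
      using bij that by (auto simp: bij_betw_def)
    have "adj a r ((dec \<circ> \<psi> \<circ> enc) m) ((dec \<circ> \<psi> \<circ> enc) n) \<longleftrightarrow> adj a r m n"
      if "m \<in> nodes" "n \<in> nodes" for m n
    proof -
      have "{\<psi> (enc m), \<psi> (enc n)} \<in> edges \<G> \<longleftrightarrow> {enc m, enc n} \<in> edges \<G>"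
        using \<psi> that by (simp add: graph_auto_def verts)
      then show ?thesis
        using edge_iff[OF closed closed, OF that] edge_iff[OF that]
        by (simp only: f_enc[OF that(1)] f_enc[OF that(2)])
    qed
    from automorphism_eq_act[OF bij this]
    obtain g where g: "g \<in> carrier G" "\<And>n. n \<in> nodes \<Longrightarrow> (dec \<circ> \<psi> \<circ> enc) n = act G a g n" by blast
    have "\<psi> = \<Phi> g"
    proof (rule extensionalityI)
      show "\<psi> x = \<Phi> g x" if "x \<in> verts \<G>" for x
      proof -
        obtain n where n: "n \<in> nodes" "x = enc n" using \<open>x \<in> verts \<G>\<close> verts by auto
        then show ?thesis using f_enc[OF n(1)] g(2)[OF n(1)] by simp
      qed
    qed (use \<psi>_Bij in \<open>simp_all add: \<Phi>_def\<close>)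
    then show ?thesis using g by blast
  qed
  have Top_one: "Top (Inr (Some \<one>\<^bsub>G\<^esub>)) \<in> nodes" by (simp add: e)
  \<comment> \<open>This vertex lies outside the copy of \<open>V\<close>, so its trivial stabiliser
    gives both the injectivity of \<open>\<Phi>\<close> and the faithfulness of
    \<open>\<rho>'\<close>.\<close>
  have free_vertex: "g = h" if "g \<in> carrier G" "h \<in> carrier G"
    "\<Phi> g (enc (Top (Inr (Some \<one>\<^bsub>G\<^esub>)))) = \<Phi> h (enc (Top (Inr (Some \<one>\<^bsub>G\<^esub>))))" for g h
    using that Top_one by (simp add: a_def del: enc.simps)
  have "\<Phi> \<in> hom G (BijGroup (verts \<G>))"
    using \<Phi>.group_hom by (simp add: group_hom_def group_hom_axioms_def)
  then have hom: "\<Phi> \<in> hom G (GraphAut \<G>)"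
    using \<Phi>_auto by (auto simp: hom_def GraphAut_def)
  have iso: "\<Phi> \<in> iso G (GraphAut \<G>)"
    unfolding iso_iff
  proof (intro conjI hom inj_onI)
    show "\<Phi> ` carrier G = carrier (GraphAut \<G>)"
      using \<Phi>_auto \<Phi>_surj by (auto simp: GraphAut_def)
  qed (auto intro: free_vertex)
  let ?W = "verts \<G> - Inl ` V"
  define \<rho>' where "\<rho>' g = restrict (\<Phi> g) ?W" for g
  have W_closed: "\<Phi> g x \<in> ?W" if "g \<in> carrier G" "x \<in> ?W" for g x
  proof -
    have "\<Phi> g x \<notin> \<Phi> g ` Inl ` V"
      using that sub \<Phi>.inj_prop[OF that(1)] by (auto simp: inj_on_def)
    then show ?thesis using that \<Phi>_V \<Phi>.element_image by auto
  qed
  have \<rho>'_action: "group_action G ?W \<rho>'"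
  proof (rule group_actionI)
    show "\<rho>' (g \<otimes>\<^bsub>G\<^esub> h) x = \<rho>' g (\<rho>' h x)" if "g \<in> carrier G" "h \<in> carrier G" "x \<in> ?W" for g h x
      using that W_closed[of h x] \<Phi>.composition_rule[of x g h] by (simp add: \<rho>'_def)
    show "\<rho>' \<one>\<^bsub>G\<^esub> x = x" if "x \<in> ?W" for x
      using that \<Phi>.id_eq_one by (simp add: \<rho>'_def flip: \<Phi>.id_eq_one)
    show "\<rho>' g x \<in> ?W" if "g \<in> carrier G" "x \<in> ?W" for g x
      using W_closed[OF that] that by (simp add: \<rho>'_def)
  qed (auto simp: \<rho>'_def \<open>group G\<close>)
  have "enc (Top (Inr (Some \<one>\<^bsub>G\<^esub>))) \<in> verts \<G>" unfolding verts using Top_one by (rule imageI)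
  then have W: "enc (Top (Inr (Some \<one>\<^bsub>G\<^esub>))) \<in> ?W" by auto
  have "inj_on \<rho>' (carrier G)"
    by (intro inj_onI free_vertex) (use W in \<open>simp_all only: \<rho>'_def restrict_apply', metis restrict_apply'\<close>)
  then have faithful: "faithful_action G ?W \<rho>'"
    using \<rho>'_action by (simp add: faithful_action_def faithful_action_axioms_def)
  have restr: "restrict (\<Phi> g) (Inl ` V) = inl_action V \<rho> g" for g
    unfolding inl_action_def by (rule restrict_ext) (auto simp: \<Phi>_Inl)
  have sum: "\<Phi> g = action_sum (Inl ` V) ?W (inl_action V \<rho>) \<rho>' g" for g
  proof (rule extensionalityI[of _ "verts \<G>"])
    show "action_sum (Inl ` V) ?W (inl_action V \<rho>) \<rho>' g \<in> extensional (verts \<G>)"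
      using sub by (auto simp: action_sum_def extensional_def)
    show "\<Phi> g x = action_sum (Inl ` V) ?W (inl_action V \<rho>) \<rho>' g x" if "x \<in> verts \<G>" for x
      using that by (simp add: action_sum_def \<rho>'_def flip: restr)
  qed (simp add: \<Phi>_def)
  \<comment> \<open>Every automorphism is some \<open>\<Phi> g\<close>, and these preserve
    \<open>V\<close> because \<open>\<rho>\<close> does.\<close>
  have V_inv: "\<psi> ` Inl ` V = Inl ` V" if "\<psi> \<in> carrier (GraphAut \<G>)" for \<psi>
  proof -
    have "\<psi> \<in> graph_auto \<G>" using that by (simp add: GraphAut_def)
    then show ?thesis using \<Phi>_surj \<Phi>_V by blast
  qed
  show ?thesis
    by (intro exI[of _ \<G>] exI[of _ \<Phi>] exI[of _ \<rho>'] conjI ballI simple sub V_inv iso restr faithful sum)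
qed

end
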